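(* Let $m_1,m_2,m_3>0$ and let a shape on a meridian be given by the differences $\theta_{ij}=\theta_i-\theta_j$ with $\sin\theta_{ij}\neq0$ for $i\neq j$. Put $A=\sqrt{D}$ with $D=\sum_\ell m_\ell^2+2\sum_{i<j}m_im_j\cos(2\theta_{ij})$, and $$F_{ij}=m_im_j\sin(\theta_{ij})\,U'(\cos\theta_{ij}),\qquad G_{ij}=m_im_j\sin(2\theta_{ij}).$$ If $A\neq0$, then $$\left|\begin{array}{cc} G_{12}-G_{23} & G_{31}-G_{12} \\ {F_{12}}-F_{23} & F_{31}-F_{12} \end{array}\right|=0$$ is a necessary and sufficient condition for the shape to satisfy the equations of motion, i.e. for the existence of $s\in\{1,-1\}$ and $\omega\in\mathbb{R}$ such that $$s\frac{\omega^2}{2A}G_{12}-F_{12}=s\frac{\omega^2}{2A}G_{23}-F_{23}=s\frac{\omega^2}{2A}G_{31}-F_{31},$$ and then for the shape to generate an Eulerian relative equilibrium on a rotating meridian.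
   Context: Three point masses $m_k>0$ lie on a meridian great circle of the unit sphere $\mathbb{S}^2$ which rotates about the $z$-axis with constant angular velocity $\omega$. The position of body $k$ on the meridian is given by a signed polar angle $\theta_k\in[-\pi,\pi]$ (angles taken modulo $2\pi$), with common longitude $\phi_k=\omega t$, i.e. position $(\sin\theta_k\cos\omega t,\sin\theta_k\sin\omega t,\cos\theta_k)$. The bodies interact through $V=\sum_{i<j}m_im_jU(\cos\sigma_{ij})$, where $\sigma_{ij}$ is the arc angle between bodies $i,j$ (here $\cos\sigma_{ij}=\cos\theta_{ij}$), the Lagrangian is kinetic energy plus $V$, and $U'(\cos\sigma)=dU/d(\cos\sigma)$ is continuous and of definite sign for $\sigma\in(0,\pi)$. A configuration $(\theta_1,\theta_2,\theta_3)$ with angular velocity $\omega$ is an Eulerian relative equilibrium on a rotating meridian iff $$\frac{\omega^2}{2}m_k\sin(2\theta_k)=m_k\sum_{j\neq k}m_j\sin(\theta_k-\theta_j)U'(\cos(\theta_k-\theta_j)),\quad k=1,2,3.$$ A shape (the set of differences $\theta_{ij}$) generates such a relative equilibrium if there are angles $\theta_1,\theta_2,\theta_3$ with these differences and some $\omega\in\mathbb{R}$ satisfying these equations. *)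

theory Defs
  imports "HOL-Analysis.Analysis" "HOL-Library.Real_Mod"
begin

text \<open>
  The three bodies carry the indices 1, 2, 3 of type nat; values of the masses \<open>m\<close>, the
  angles \<open>\<theta>\<close> and the differences \<open>d\<close> at other indices are never used. The potential \<open>U\<close> is a
  function of the cosine of the arc angle, so \<open>deriv U\<close> is the derivative with respect to
  that cosine.
\<close>

definition admissible_potential :: "(real \<Rightarrow> real) \<Rightarrow> bool" where
  "admissible_potential U \<longleftrightarrow>
     (\<forall>\<sigma>\<in>{0<..<pi}. U differentiable at (cos \<sigma>)) \<and>
     continuous_on {0<..<pi} (\<lambda>\<sigma>. deriv U (cos \<sigma>)) \<and>
     ((\<forall>\<sigma>\<in>{0<..<pi}. deriv U (cos \<sigma>) > 0) \<or> (\<forall>\<sigma>\<in>{0<..<pi}. deriv U (cos \<sigma>) < 0))"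

text \<open>
  Polar angles are signed, lie in the interval from \<open>-\<pi>\<close> to \<open>\<pi>\<close>, and matter only modulo
  \<open>2\<pi>\<close>; hence the differences are compared modulo \<open>2\<pi>\<close> as well.
\<close>

definition meridian_configuration :: "(nat \<Rightarrow> real) \<Rightarrow> bool" where
  "meridian_configuration \<theta> \<longleftrightarrow> (\<forall>k\<in>{1..3}. \<theta> k \<in> {-pi..pi})"

definition has_differences :: "(nat \<Rightarrow> real) \<Rightarrow> (nat \<Rightarrow> nat \<Rightarrow> real) \<Rightarrow> bool" where
  "has_differences \<theta> d \<longleftrightarrow>
     (\<forall>i\<in>{1..3}. \<forall>j\<in>{1..3}. [\<theta> i - \<theta> j = d i j] (rmod (2 * pi)))"

definition is_shape :: "(nat \<Rightarrow> nat \<Rightarrow> real) \<Rightarrow> bool" where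
  "is_shape d \<longleftrightarrow> (\<exists>\<theta>. meridian_configuration \<theta> \<and> has_differences \<theta> d)"

definition eulerian_rel_equilibrium ::
    "(nat \<Rightarrow> real) \<Rightarrow> (real \<Rightarrow> real) \<Rightarrow> (nat \<Rightarrow> real) \<Rightarrow> real \<Rightarrow> bool" where
  "eulerian_rel_equilibrium m U \<theta> \<omega> \<longleftrightarrow>
     (\<forall>k\<in>{1..3}.
        \<omega>\<^sup>2 / 2 * m k * sin (2 * \<theta> k) =
        m k * (\<Sum>j\<in>{1..3} - {k}. m j * sin (\<theta> k - \<theta> j) * deriv U (cos (\<theta> k - \<theta> j))))"

definition generates_rel_equilibrium ::
    "(nat \<Rightarrow> real) \<Rightarrow> (real \<Rightarrow> real) \<Rightarrow> (nat \<Rightarrow> nat \<Rightarrow> real) \<Rightarrow> bool" where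
  "generates_rel_equilibrium m U d \<longleftrightarrow>
     (\<exists>\<theta> \<omega>. meridian_configuration \<theta> \<and> has_differences \<theta> d \<and>
        eulerian_rel_equilibrium m U \<theta> \<omega>)"

definition shape_D :: "(nat \<Rightarrow> real) \<Rightarrow> (nat \<Rightarrow> nat \<Rightarrow> real) \<Rightarrow> real" where
  "shape_D m d =
     (\<Sum>l\<in>{1..3}. (m l)\<^sup>2) + 2 * (\<Sum>j\<in>{1..3}. \<Sum>i\<in>{1..<j}. m i * m j * cos (2 * d i j))"

definition shape_A :: "(nat \<Rightarrow> real) \<Rightarrow> (nat \<Rightarrow> nat \<Rightarrow> real) \<Rightarrow> real" where
  "shape_A m d = sqrt (shape_D m d)"

definition shape_F ::
    "(nat \<Rightarrow> real) \<Rightarrow> (real \<Rightarrow> real) \<Rightarrow> (nat \<Rightarrow> nat \<Rightarrow> real) \<Rightarrow> nat \<Rightarrow> nat \<Rightarrow> real" where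
  "shape_F m U d i j = m i * m j * sin (d i j) * deriv U (cos (d i j))"

definition shape_G :: "(nat \<Rightarrow> real) \<Rightarrow> (nat \<Rightarrow> nat \<Rightarrow> real) \<Rightarrow> nat \<Rightarrow> nat \<Rightarrow> real" where
  "shape_G m d i j = m i * m j * sin (2 * d i j)"

definition satisfies_shape_equations ::
    "(nat \<Rightarrow> real) \<Rightarrow> (real \<Rightarrow> real) \<Rightarrow> (nat \<Rightarrow> nat \<Rightarrow> real) \<Rightarrow> real \<Rightarrow> real \<Rightarrow> bool" where
  "satisfies_shape_equations m U d s \<omega> \<longleftrightarrow>
     (let A = shape_A m d; F = shape_F m U d; G = shape_G m d;
          E = (\<lambda>i j. s * (\<omega>\<^sup>2 / (2 * A)) * G i j - F i j)
      in E 1 2 = E 2 3 \<and> E 2 3 = E 3 1)"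

definition shape_matrix ::
    "(nat \<Rightarrow> real) \<Rightarrow> (real \<Rightarrow> real) \<Rightarrow> (nat \<Rightarrow> nat \<Rightarrow> real) \<Rightarrow> real ^ 2 ^ 2" where
  "shape_matrix m U d =
     (let F = shape_F m U d; G = shape_G m d
      in vector [vector [G 1 2 - G 2 3, G 3 1 - G 1 2],
                 vector [F 1 2 - F 2 3, F 3 1 - F 1 2]])"

end

theory Submission
  imports Defs
begin

text \<open>
  Attach to a configuration the complex number \<open>W = \<Sum>k. m k * cis (2 * \<theta> k)\<close>. Its modulus
  is \<open>shape_A\<close>, so it depends on the shape alone, while rotating the configuration along the
  meridian by \<open>\<alpha>\<close> multiplies \<open>W\<close> by \<open>cis (2 * \<alpha>)\<close>. Adding the three equations of a relative
  equilibrium cancels the internal forces and leaves \<open>\<omega>\<^sup>2 * Im W = 0\<close>; hence \<open>W\<close> is \<open>A\<close> or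
  \<open>-A\<close> unless \<open>\<omega> = 0\<close>, and conversely any shape can be rotated into a position in which \<open>W\<close>
  is whichever of \<open>A\<close> and \<open>-A\<close> is desired. In such a position the imaginary part of
  \<open>cnj W * m k * cis (2 * \<theta> k)\<close> shows that the centrifugal term \<open>m k * sin (2 * \<theta> k)\<close>
  equals \<open>s / A\<close> times the row sum \<open>\<Sum>j. G k j\<close> (lemma \<open>centrifugal_term_aligned\<close>). The
  equations of motion therefore say that the row sums of \<open>F\<close> are \<open>s * \<omega>\<^sup>2 / (2 * A)\<close> times
  those of \<open>G\<close>, and as \<open>F\<close> and \<open>G\<close> are antisymmetric these are exactly the shape equations
  (lemmas \<open>antisym_cyclic_eq_iff_row_sums_zero\<close> and \<open>generates_iff_shape_equations\<close>).

  Since \<open>s * \<omega>\<^sup>2 / (2 * A)\<close> runs through all reals, the shape equations are solvable iff the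
  row sums of \<open>F\<close> are a multiple of those of \<open>G\<close>. The determinant tests whether the two
  vectors of row sums are linearly dependent, which is the same provided the row sums of \<open>G\<close>
  do not all vanish. They cannot (lemma \<open>shape_G_row_sum_nonzero\<close>): otherwise every
  \<open>cis (2 * \<theta> k)\<close> would be parallel to \<open>W\<close>, so any two bodies would be a quarter turn apart
  modulo \<open>\<pi>\<close>; but two quarter turns make a half turn, so \<open>\<theta> 1 - \<theta> 3\<close> could not be a
  quarter turn when \<open>\<theta> 1 - \<theta> 2\<close> and \<open>\<theta> 2 - \<theta> 3\<close> are.
\<close>

section \<open>Antisymmetric arrays on three indices\<close>

lemma sum_1_to_3: "(\<Sum>k\<in>{1..3::nat}. f k) = f 1 + f 2 + f 3"
  for f :: "nat \<Rightarrow> 'a::comm_monoid_add"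
proof -
  have "{1..3::nat} = {1, 2, 3}" by auto
  then show ?thesis by (simp add: add.assoc)
qed

lemma ball_1_to_3: "(\<forall>k\<in>{1..3::nat}. P k) \<longleftrightarrow> P 1 \<and> P 2 \<and> P 3"
proof -
  have "{1..3::nat} = {1, 2, 3}" by auto
  then show ?thesis by simp
qed

text \<open>
  The diagonal vanishes, and the entries against the cyclic order \<open>1, 2, 3\<close> are the negatives
  of those along it. This is what makes a statement about \<open>E 1 2\<close>, \<open>E 2 3\<close>, \<open>E 3 1\<close> one about
  the total force on each body.
\<close>

lemma antisym_row_sums:
  fixes E :: "nat \<Rightarrow> nat \<Rightarrow> real"
  assumes "\<forall>i\<in>{1..3}. \<forall>j\<in>{1..3}. E i j = - E j i"
  shows "(\<Sum>j\<in>{1..3}. E 1 j) = E 1 2 - E 3 1"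
    and "(\<Sum>j\<in>{1..3}. E 2 j) = E 2 3 - E 1 2"
    and "(\<Sum>j\<in>{1..3}. E 3 j) = E 3 1 - E 2 3"
  unfolding sum_1_to_3
  using assms unfolding ball_1_to_3 by linarith+

lemma antisym_cyclic_eq_iff_row_sums_zero:
  fixes E :: "nat \<Rightarrow> nat \<Rightarrow> real"
  assumes "\<forall>i\<in>{1..3}. \<forall>j\<in>{1..3}. E i j = - E j i"
  shows "(E 1 2 = E 2 3 \<and> E 2 3 = E 3 1) \<longleftrightarrow> (\<forall>k\<in>{1..3}. (\<Sum>j\<in>{1..3}. E k j) = 0)"
  unfolding ball_1_to_3 antisym_row_sums[OF assms] by auto

section \<open>Forces in terms of the angles\<close>

lemma
  assumes "has_differences \<theta> d" "i \<in> {1..3}" "j \<in> {1..3}"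
  shows sin_difference: "sin (d i j) = sin (\<theta> i - \<theta> j)"
    and cos_difference: "cos (d i j) = cos (\<theta> i - \<theta> j)"
    and sin_double_difference: "sin (2 * d i j) = sin (2 * \<theta> i - 2 * \<theta> j)"
    and cos_double_difference: "cos (2 * d i j) = cos (2 * \<theta> i - 2 * \<theta> j)"
proof -
  have "[d i j = \<theta> i - \<theta> j] (rmod (2 * pi))"
    using assms by (auto simp: has_differences_def intro: rcong_sym)
  then have "cis (d i j) = cis (\<theta> i - \<theta> j)"
    by (simp add: cis_eq_iff)
  then show *: "sin (d i j) = sin (\<theta> i - \<theta> j)" "cos (d i j) = cos (\<theta> i - \<theta> j)"
    by (simp_all add: complex_eq_iff)
  show "sin (2 * d i j) = sin (2 * \<theta> i - 2 * \<theta> j)" "cos (2 * d i j) = cos (2 * \<theta> i - 2 * \<theta> j)"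
    using * sin_double[of "d i j"] sin_double[of "\<theta> i - \<theta> j"]
      cos_double[of "d i j"] cos_double[of "\<theta> i - \<theta> j"]
    by (simp_all add: algebra_simps)
qed

lemma shape_F_antisym:
  assumes "has_differences \<theta> d"
  shows "\<forall>i\<in>{1..3}. \<forall>j\<in>{1..3}. shape_F m U d i j = - shape_F m U d j i"
proof (intro ballI)
  fix i j :: nat
  assume "i \<in> {1..3}" "j \<in> {1..3}"
  then show "shape_F m U d i j = - shape_F m U d j i"
    using assms sin_minus[of "\<theta> i - \<theta> j"] cos_minus[of "\<theta> i - \<theta> j"]
    by (simp add: shape_F_def sin_difference cos_difference)
qed

lemma shape_G_antisym:
  assumes "has_differences \<theta> d"
  shows "\<forall>i\<in>{1..3}. \<forall>j\<in>{1..3}. shape_G m d i j = - shape_G m d j i"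
proof (intro ballI)
  fix i j :: nat
  assume "i \<in> {1..3}" "j \<in> {1..3}"
  then show "shape_G m d i j = - shape_G m d j i"
    using assms sin_minus[of "2 * \<theta> i - 2 * \<theta> j"]
    by (simp add: shape_G_def sin_double_difference)
qed

lemma shape_equations_iff_row_sums:
  assumes "has_differences \<theta> d"
  shows "satisfies_shape_equations m U d s \<omega> \<longleftrightarrow>
    (\<forall>k\<in>{1..3}. s * (\<omega>\<^sup>2 / (2 * shape_A m d)) * (\<Sum>j\<in>{1..3}. shape_G m d k j) =
       (\<Sum>j\<in>{1..3}. shape_F m U d k j))"
proof -
  define E where
    "E i j = s * (\<omega>\<^sup>2 / (2 * shape_A m d)) * shape_G m d i j - shape_F m U d i j" for i j
  have "\<forall>i\<in>{1..3}. \<forall>j\<in>{1..3}. E i j = - E j i"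
  proof (intro ballI)
    fix i j :: nat
    assume "i \<in> {1..3}" "j \<in> {1..3}"
    then have "shape_F m U d i j = - shape_F m U d j i" "shape_G m d i j = - shape_G m d j i"
      using shape_F_antisym[OF assms] shape_G_antisym[OF assms] by blast+
    then show "E i j = - E j i"
      unfolding E_def by simp
  qed
  then have "(E 1 2 = E 2 3 \<and> E 2 3 = E 3 1) \<longleftrightarrow> (\<forall>k\<in>{1..3}. (\<Sum>j\<in>{1..3}. E k j) = 0)"
    by (rule antisym_cyclic_eq_iff_row_sums_zero)
  then show ?thesis
    by (simp add: satisfies_shape_equations_def Let_def E_def sum_subtractf sum_distrib_left)
qed

text \<open>
  The diagonal entry \<open>shape_F m U d k k\<close> vanishes, so the sum over the other two bodies can be
  taken over all three.
\<close>

lemma equilibrium_iff_row_sums: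
  assumes "has_differences \<theta> d"
  shows "eulerian_rel_equilibrium m U \<theta> \<omega> \<longleftrightarrow>
    (\<forall>k\<in>{1..3}. \<omega>\<^sup>2 / 2 * (m k * sin (2 * \<theta> k)) = (\<Sum>j\<in>{1..3}. shape_F m U d k j))"
proof -
  have "m k * (\<Sum>j\<in>{1..3} - {k}. m j * sin (\<theta> k - \<theta> j) * deriv U (cos (\<theta> k - \<theta> j))) =
      (\<Sum>j\<in>{1..3}. shape_F m U d k j)" if k: "k \<in> {1..3}" for k
  proof -
    have "(\<Sum>j\<in>{1..3}. shape_F m U d k j) =
        (\<Sum>j\<in>{1..3}. m k * (m j * sin (\<theta> k - \<theta> j) * deriv U (cos (\<theta> k - \<theta> j))))"
      using assms k
      by (intro sum.cong refl)
        (simp add: shape_F_def sin_difference cos_difference mult.assoc)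
    also have "\<dots> =
        (\<Sum>j\<in>{1..3} - {k}. m k * (m j * sin (\<theta> k - \<theta> j) * deriv U (cos (\<theta> k - \<theta> j))))"
      by (rule sum.mono_neutral_right) auto
    finally show ?thesis by (simp add: sum_distrib_left)
  qed
  then show ?thesis
    by (simp add: eulerian_rel_equilibrium_def mult.assoc)
qed

section \<open>The doubled-angle moment and rotations along the meridian\<close>

definition doubled_angle_moment :: "(nat \<Rightarrow> real) \<Rightarrow> (nat \<Rightarrow> real) \<Rightarrow> complex" where
  "doubled_angle_moment m \<theta> = (\<Sum>k\<in>{1..3}. m k * cis (2 * \<theta> k))"

lemma Re_doubled_angle_moment:
  "Re (doubled_angle_moment m \<theta>) = (\<Sum>k\<in>{1..3}. m k * cos (2 * \<theta> k))"
  and Im_doubled_angle_moment: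
  "Im (doubled_angle_moment m \<theta>) = (\<Sum>k\<in>{1..3}. m k * sin (2 * \<theta> k))"
  by (simp_all add: doubled_angle_moment_def)

text \<open>
  Expanding \<open>W * cnj W\<close> gives the squares of the masses and twice the cosines of the doubled
  differences.
\<close>

lemma shape_A_eq_cmod_moment:
  assumes "has_differences \<theta> d"
  shows "shape_A m d = cmod (doubled_angle_moment m \<theta>)"
proof -
  have pairs: "(\<Sum>j\<in>{1..3}. \<Sum>i\<in>{1..<j}. f i j) = f 1 2 + f 1 3 + f 2 3"
    for f :: "nat \<Rightarrow> nat \<Rightarrow> real"
  proof -
    have "{1..<3::nat} = {1, 2}" "{1..<2::nat} = {1}" by auto
    then show ?thesis unfolding sum_1_to_3 by simp
  qed
  have unit: "(cos (2 * \<theta> k))\<^sup>2 = 1 - (sin (2 * \<theta> k))\<^sup>2" for k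
    by (rule cos_squared_eq)
  have "shape_D m d = (Re (doubled_angle_moment m \<theta>))\<^sup>2 + (Im (doubled_angle_moment m \<theta>))\<^sup>2"
    unfolding shape_D_def pairs Re_doubled_angle_moment Im_doubled_angle_moment sum_1_to_3
      power2_sum power_mult_distrib unit
    by (simp add: cos_double_difference[OF assms] cos_diff algebra_simps)
  then show ?thesis
    by (simp add: shape_A_def cmod_def)
qed

text \<open>
  Both sides are the imaginary part of \<open>cnj W * m k * cis (2 * \<theta> k)\<close>.
\<close>

lemma moment_cross_body:
  assumes "has_differences \<theta> d" "k \<in> {1..3}"
  shows "m k * (sin (2 * \<theta> k) * Re (doubled_angle_moment m \<theta>) -
      cos (2 * \<theta> k) * Im (doubled_angle_moment m \<theta>)) = (\<Sum>j\<in>{1..3}. shape_G m d k j)"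
  unfolding Re_doubled_angle_moment Im_doubled_angle_moment sum_1_to_3 shape_G_def
  using assms by (simp add: sin_double_difference sin_diff algebra_simps)

lemma centrifugal_term_aligned:
  assumes "has_differences \<theta> d" "k \<in> {1..3}" "shape_A m d \<noteq> 0" "s \<in> {1, -1}"
    and "doubled_angle_moment m \<theta> = of_real (s * shape_A m d)"
  shows "m k * sin (2 * \<theta> k) = s / shape_A m d * (\<Sum>j\<in>{1..3}. shape_G m d k j)"
  using moment_cross_body[OF assms(1,2), of m] assms(3-5) by (auto simp: field_simps)

lemma equilibrium_aligned_iff:
  assumes "has_differences \<theta> d" "shape_A m d \<noteq> 0" "s \<in> {1, -1}"
    and "doubled_angle_moment m \<theta> = of_real (s * shape_A m d)"
  shows "eulerian_rel_equilibrium m U \<theta> \<omega> \<longleftrightarrow> satisfies_shape_equations m U d s \<omega>"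
proof -
  have "\<omega>\<^sup>2 / 2 * (m k * sin (2 * \<theta> k)) =
      s * (\<omega>\<^sup>2 / (2 * shape_A m d)) * (\<Sum>j\<in>{1..3}. shape_G m d k j)" if "k \<in> {1..3}" for k
    unfolding centrifugal_term_aligned[OF assms(1) that assms(2-4)] by simp
  then show ?thesis
    unfolding equilibrium_iff_row_sums[OF assms(1)] shape_equations_iff_row_sums[OF assms(1)]
    by (intro ball_cong refl) metis
qed

lemma meridian_rotation:
  assumes "has_differences \<theta> d"
  obtains \<theta>' where "meridian_configuration \<theta>'" "has_differences \<theta>' d"
    "doubled_angle_moment m \<theta>' = cis (2 * \<alpha>) * doubled_angle_moment m \<theta>"
proof
  \<comment> \<open>the representative of \<open>\<theta> k + \<alpha>\<close> modulo \<open>2\<pi>\<close> that lies between \<open>-\<pi>\<close> and \<open>\<pi>\<close>\<close>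
  define \<theta>' where "\<theta>' k = (\<theta> k + \<alpha> + pi) rmod (2 * pi) - pi" for k
  have rot: "[\<theta>' k = \<theta> k + \<alpha>] (rmod (2 * pi))" for k
    unfolding \<theta>'_def using rcong_diff[OF rcong_rmod_left[OF rcong_refl] rcong_refl]
    by (metis add_diff_cancel_right')
  show "meridian_configuration \<theta>'"
    using rmod_nonneg[of "2 * pi"] rmod_le[of "2 * pi"]
    by (auto simp: meridian_configuration_def \<theta>'_def diff_le_eq)
  have "[\<theta>' i - \<theta>' j = \<theta> i - \<theta> j] (rmod (2 * pi))" for i j
    using rcong_diff[OF rot rot, of i j] by simp
  then show "has_differences \<theta>' d"
    using assms unfolding has_differences_def by (meson rcong_trans)
  have "cis (2 * \<theta>' k) = cis (2 * \<alpha>) * cis (2 * \<theta> k)" for k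
  proof -
    have "cis (\<theta>' k) = cis (\<theta> k + \<alpha>)"
      using rot by (simp add: cis_eq_iff)
    then have "cis (\<theta>' k + \<theta>' k) = cis ((\<theta> k + \<alpha>) + (\<theta> k + \<alpha>))"
      unfolding cis_mult[symmetric] by simp
    then show ?thesis by (simp add: cis_mult algebra_simps)
  qed
  then show "doubled_angle_moment m \<theta>' = cis (2 * \<alpha>) * doubled_angle_moment m \<theta>"
    by (simp add: doubled_angle_moment_def sum_distrib_left mult.left_commute)
qed

lemma aligned_configuration:
  assumes "has_differences \<theta> d" "s \<in> {1, -1}"
  obtains \<theta>' where "meridian_configuration \<theta>'" "has_differences \<theta>' d"
    "doubled_angle_moment m \<theta>' = of_real (s * shape_A m d)"
proof -
  let ?W = "doubled_angle_moment m \<theta>"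
  define \<alpha> where "\<alpha> = (Arg (of_real s) - Arg ?W) / 2"
  have angle: "2 * \<alpha> + Arg ?W = Arg (of_real s)"
    by (simp add: \<alpha>_def diff_divide_distrib del: Arg_of_real)
  obtain \<theta>' where \<theta>': "meridian_configuration \<theta>'" "has_differences \<theta>' d"
    "doubled_angle_moment m \<theta>' = cis (2 * \<alpha>) * ?W"
    using meridian_rotation[OF assms(1)] .
  have "cis (2 * \<alpha>) * ?W = cis (2 * \<alpha>) * (cmod ?W * cis (Arg ?W))"
    using rcis_cmod_Arg[of ?W] by (simp add: rcis_def)
  also have "\<dots> = cmod ?W * cis (Arg (of_real s))"
    unfolding mult.left_commute[of "cis (2 * \<alpha>)"] cis_mult angle by simp
  also have "cis (Arg (of_real s)) = of_real s"
    using rcis_cmod_Arg[of "of_real s"] assms(2) by (auto simp: rcis_def)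
  finally show thesis
    using that[of \<theta>'] \<theta>' shape_A_eq_cmod_moment[OF assms(1)] by (simp add: mult.commute)
qed

section \<open>Relative equilibria and the shape equations\<close>

lemma generates_iff_shape_equations:
  assumes "is_shape d" "shape_A m d \<noteq> 0"
  shows "generates_rel_equilibrium m U d \<longleftrightarrow>
    (\<exists>s\<in>{1, -1}. \<exists>\<omega>. satisfies_shape_equations m U d s \<omega>)"
proof
  assume "generates_rel_equilibrium m U d"
  then obtain \<theta> \<omega> where \<theta>: "has_differences \<theta> d" and eq: "eulerian_rel_equilibrium m U \<theta> \<omega>"
    by (auto simp: generates_rel_equilibrium_def)
  let ?W = "doubled_angle_moment m \<theta>"
  have rows: "\<omega>\<^sup>2 / 2 * (m k * sin (2 * \<theta> k)) = (\<Sum>j\<in>{1..3}. shape_F m U d k j)"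
    if "k \<in> {1..3}" for k
    using eq that by (simp add: equilibrium_iff_row_sums[OF \<theta>])
  show "\<exists>s\<in>{1, -1}. \<exists>\<omega>. satisfies_shape_equations m U d s \<omega>"
  proof (cases "\<omega> = 0")
    case True
    then have "satisfies_shape_equations m U d 1 \<omega>"
      using rows by (simp add: shape_equations_iff_row_sums[OF \<theta>])
    then show ?thesis by blast
  next
    case False
    \<comment> \<open>internal forces cancel in the sum of the three equations\<close>
    have "\<omega>\<^sup>2 / 2 * Im ?W = (\<Sum>k\<in>{1..3}. \<Sum>j\<in>{1..3}. shape_F m U d k j)"
      unfolding Im_doubled_angle_moment sum_distrib_left by (intro sum.cong refl rows)
    also have "\<dots> = 0"
      unfolding sum_1_to_3[of "\<lambda>k. \<Sum>j\<in>{1..3}. shape_F m U d k j"]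
        antisym_row_sums[OF shape_F_antisym[OF \<theta>]] by simp
    finally have Im: "Im ?W = 0" using False by simp
    define s :: real where "s = (if Re ?W \<ge> 0 then 1 else -1)"
    have s: "s \<in> {1, -1}" by (simp add: s_def)
    have "?W = of_real (s * shape_A m d)"
      using Im by (simp add: shape_A_eq_cmod_moment[OF \<theta>] s_def complex_eq_iff cmod_eq_Re)
    then show ?thesis
      using equilibrium_aligned_iff[OF \<theta> assms(2) s] eq s by blast
  qed
next
  assume "\<exists>s\<in>{1, -1}. \<exists>\<omega>. satisfies_shape_equations m U d s \<omega>"
  then obtain s \<omega> where s: "s \<in> {1, -1}" and eq: "satisfies_shape_equations m U d s \<omega>"
    by blast
  obtain \<theta>\<^sub>0 where "has_differences \<theta>\<^sub>0 d"
    using assms(1) by (auto simp: is_shape_def)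
  then obtain \<theta> where "meridian_configuration \<theta>" and \<theta>: "has_differences \<theta> d"
    and "doubled_angle_moment m \<theta> = of_real (s * shape_A m d)"
    using aligned_configuration s by blast
  then show "generates_rel_equilibrium m U d"
    using equilibrium_aligned_iff[OF \<theta> assms(2) s] eq
    by (auto simp: generates_rel_equilibrium_def)
qed

section \<open>The determinant condition\<close>

text \<open>
  Without this, a vanishing determinant could come from a zero \<open>G\<close> row in the matrix and say
  nothing about \<open>F\<close>.
\<close>

lemma shape_G_row_sum_nonzero:
  assumes \<theta>: "has_differences \<theta> d" and "\<And>k. k \<in> {1..3} \<Longrightarrow> m k \<noteq> 0"
    and apart: "\<And>i j. i \<in> {1..3} \<Longrightarrow> j \<in> {1..3} \<Longrightarrow> i \<noteq> j \<Longrightarrow> sin (d i j) \<noteq> 0"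
    and "shape_A m d \<noteq> 0"
  obtains k where "k \<in> {1..3}" "(\<Sum>j\<in>{1..3}. shape_G m d k j) \<noteq> 0"
proof -
  let ?C = "Re (doubled_angle_moment m \<theta>)" and ?S = "Im (doubled_angle_moment m \<theta>)"
  have False if zero: "\<And>k. k \<in> {1..3} \<Longrightarrow> (\<Sum>j\<in>{1..3}. shape_G m d k j) = 0"
  proof -
    have parallel: "sin (2 * \<theta> k) * ?C = cos (2 * \<theta> k) * ?S" if "k \<in> {1..3}" for k
      using moment_cross_body[OF \<theta> that, of m] zero[OF that] assms(2)[OF that] by simp
    have CS: "?C \<noteq> 0 \<or> ?S \<noteq> 0"
      using assms(4) by (auto simp: shape_A_eq_cmod_moment[OF \<theta>] complex_eq_iff)
    have quarter: "cos (\<theta> i - \<theta> j) = 0" if ij: "i \<in> {1..3}" "j \<in> {1..3}" "i \<noteq> j" for i j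
    proof -
      \<comment> \<open>two directions parallel to the same nonzero vector \<open>W\<close> are parallel to each other\<close>
      have "?C * sin (2 * \<theta> i - 2 * \<theta> j) =
          (sin (2 * \<theta> i) * ?C) * cos (2 * \<theta> j) - cos (2 * \<theta> i) * (sin (2 * \<theta> j) * ?C)"
        by (simp add: sin_diff algebra_simps)
      also have "\<dots> = 0" unfolding parallel[OF ij(1)] parallel[OF ij(2)] by simp
      finally have C: "?C * sin (2 * \<theta> i - 2 * \<theta> j) = 0" .
      have "?S * sin (2 * \<theta> i - 2 * \<theta> j) =
          sin (2 * \<theta> i) * (cos (2 * \<theta> j) * ?S) - (cos (2 * \<theta> i) * ?S) * sin (2 * \<theta> j)"
        by (simp add: sin_diff algebra_simps)
      also have "\<dots> = 0" unfolding parallel[OF ij(1), symmetric] parallel[OF ij(2), symmetric] by simp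
      finally have "sin (2 * \<theta> i - 2 * \<theta> j) = 0" using C CS by auto
      then have "sin (\<theta> i - \<theta> j) * cos (\<theta> i - \<theta> j) = 0"
        using sin_double[of "\<theta> i - \<theta> j"] by (simp add: algebra_simps)
      then show ?thesis
        using apart[OF ij] sin_difference[OF \<theta> ij(1,2)] by simp
    qed
    have "cos (\<theta> 1 - \<theta> 3) = cos ((\<theta> 1 - \<theta> 2) + (\<theta> 2 - \<theta> 3))" by simp
    also have "\<dots> = - (sin (\<theta> 1 - \<theta> 2) * sin (\<theta> 2 - \<theta> 3))"
      unfolding cos_add by (simp add: quarter)
    finally have "sin (\<theta> 1 - \<theta> 2) * sin (\<theta> 2 - \<theta> 3) = 0"
      by (simp add: quarter)
    then show False
      using apart[of 1 2] apart[of 2 3] sin_difference[OF \<theta>, of 1 2] sin_difference[OF \<theta>, of 2 3]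
      by simp
  qed
  then show thesis using that by blast
qed

text \<open>
  The entries of the matrix are, up to sign, the first two row sums of \<open>G\<close> and of \<open>F\<close>; the
  third row sum is minus the sum of these two. The multiplier \<open>c\<close> is read off from a nonzero
  row sum of \<open>G\<close>.
\<close>

lemma det_shape_matrix_zero_iff:
  assumes \<theta>: "has_differences \<theta> d" and "\<And>k. k \<in> {1..3} \<Longrightarrow> m k \<noteq> 0"
    and "\<And>i j. i \<in> {1..3} \<Longrightarrow> j \<in> {1..3} \<Longrightarrow> i \<noteq> j \<Longrightarrow> sin (d i j) \<noteq> 0"
    and "shape_A m d \<noteq> 0"
  shows "det (shape_matrix m U d) = 0 \<longleftrightarrow>
    (\<exists>c. \<forall>k\<in>{1..3}. c * (\<Sum>j\<in>{1..3}. shape_G m d k j) = (\<Sum>j\<in>{1..3}. shape_F m U d k j))"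
proof -
  define g f where "g k = (\<Sum>j\<in>{1..3}. shape_G m d k j)"
    and "f k = (\<Sum>j\<in>{1..3}. shape_F m U d k j)" for k
  note g = antisym_row_sums[OF shape_G_antisym[OF \<theta>, of m], folded g_def]
  note f = antisym_row_sums[OF shape_F_antisym[OF \<theta>, of m U], folded f_def]
  have g3: "g 3 = - g 1 - g 2" and f3: "f 3 = - f 1 - f 2"
    unfolding g f by simp_all
  have det: "det (shape_matrix m U d) = g 2 * f 1 - g 1 * f 2"
    unfolding shape_matrix_def Let_def det_2 g f by (simp add: algebra_simps)
  obtain k where "k \<in> {1..3}" "g k \<noteq> 0"
    using shape_G_row_sum_nonzero[OF assms] unfolding g_def by blast
  then have "\<not> (\<forall>k\<in>{1..3}. g k = 0)" by blast
  then have nz: "g 1 \<noteq> 0 \<or> g 2 \<noteq> 0"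
    unfolding ball_1_to_3 g3 by auto
  have "g 2 * f 1 - g 1 * f 2 = 0 \<longleftrightarrow> (\<exists>c. c * g 1 = f 1 \<and> c * g 2 = f 2)"
  proof
    assume dep: "g 2 * f 1 - g 1 * f 2 = 0"
    show "\<exists>c. c * g 1 = f 1 \<and> c * g 2 = f 2"
    proof (cases "g 1 = 0")
      case True
      then show ?thesis
        using nz dep by (intro exI[of _ "f 2 / g 2"]) simp
    next
      case False
      then show ?thesis
        using dep by (intro exI[of _ "f 1 / g 1"]) (simp add: field_simps)
    qed
  next
    assume "\<exists>c. c * g 1 = f 1 \<and> c * g 2 = f 2"
    then obtain c where "f 1 = c * g 1" "f 2 = c * g 2" by metis
    then show "g 2 * f 1 - g 1 * f 2 = 0" by simp
  qed
  moreover have "c * g 3 = f 3" if "c * g 1 = f 1" "c * g 2 = f 2" for c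
    unfolding g3 f3 that[symmetric] by (simp add: algebra_simps)
  ultimately show ?thesis
    unfolding det ball_1_to_3 g_def[symmetric] f_def[symmetric] by blast
qed

lemma real_eq_signed_square:
  fixes c A :: real
  assumes "A > 0"
  obtains s \<omega> where "s \<in> {1, -1}" "c = s * (\<omega>\<^sup>2 / (2 * A))"
proof
  show "(if c \<ge> 0 then 1 else -1) \<in> {1, -1::real}" by simp
  show "c = (if c \<ge> 0 then 1 else -1) * ((sqrt (2 * A * \<bar>c\<bar>))\<^sup>2 / (2 * A))"
    using assms by simp
qed

theorem theorem2:
  fixes m :: "nat \<Rightarrow> real" and U :: "real \<Rightarrow> real" and d :: "nat \<Rightarrow> nat \<Rightarrow> real"
  assumes "\<And>k. k \<in> {1..3} \<Longrightarrow> m k > 0"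
    and "admissible_potential U"
    and "is_shape d"
    and "\<And>i j. i \<in> {1..3} \<Longrightarrow> j \<in> {1..3} \<Longrightarrow> i \<noteq> j \<Longrightarrow> sin (d i j) \<noteq> 0"
    and "shape_A m d \<noteq> 0"
  shows "(det (shape_matrix m U d) = 0 \<longleftrightarrow>
            (\<exists>s\<in>{1, -1}. \<exists>\<omega>. satisfies_shape_equations m U d s \<omega>)) \<and>
         (det (shape_matrix m U d) = 0 \<longleftrightarrow> generates_rel_equilibrium m U d)"
proof -
  obtain \<theta> where \<theta>: "has_differences \<theta> d"
    using assms(3) by (auto simp: is_shape_def)
  have A: "shape_A m d > 0"
    using assms(5) by (simp add: shape_A_eq_cmod_moment[OF \<theta>])
  have masses: "m k \<noteq> 0" if "k \<in> {1..3}" for k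
    using assms(1)[OF that] by simp
  have det: "det (shape_matrix m U d) = 0 \<longleftrightarrow> (\<exists>c. \<forall>k\<in>{1..3}.
      c * (\<Sum>j\<in>{1..3}. shape_G m d k j) = (\<Sum>j\<in>{1..3}. shape_F m U d k j))"
    by (rule det_shape_matrix_zero_iff[OF \<theta>]) (fact masses assms(4,5))+
  have "det (shape_matrix m U d) = 0 \<longleftrightarrow>
      (\<exists>s\<in>{1, -1}. \<exists>\<omega>. satisfies_shape_equations m U d s \<omega>)"
  proof
    assume "det (shape_matrix m U d) = 0"
    then obtain c where c: "\<forall>k\<in>{1..3}. c * (\<Sum>j\<in>{1..3}. shape_G m d k j) =
        (\<Sum>j\<in>{1..3}. shape_F m U d k j)"
      unfolding det ..
    obtain s \<omega> where s: "s \<in> {1, -1}" and "c = s * (\<omega>\<^sup>2 / (2 * shape_A m d))"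
      using real_eq_signed_square[OF A] .
    then have "satisfies_shape_equations m U d s \<omega>"
      using c unfolding shape_equations_iff_row_sums[OF \<theta>] by blast
    with s show "\<exists>s\<in>{1, -1}. \<exists>\<omega>. satisfies_shape_equations m U d s \<omega>" by blast
  next
    assume "\<exists>s\<in>{1, -1}. \<exists>\<omega>. satisfies_shape_equations m U d s \<omega>"
    then show "det (shape_matrix m U d) = 0"
      unfolding det shape_equations_iff_row_sums[OF \<theta>] by blast
  qed
  then show ?thesis
    using generates_iff_shape_equations[OF assms(3,5)] by simp
qed

end
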